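(* Let $p$ be a prime and let $(\mathbb Z_p,\tau)$ be a quasilinear cycle set structure on the cyclic group $\mathbb Z_p=\mathbb Z/p\mathbb Z$. Then there is an $\alpha\in\mathbb Z_p\setminus\{0\}$ such that $\tau(a)=\alpha\cdot a$ for all $a\in\mathbb Z_p$.
   Context: A cycle set is a set $X$ with a binary operation $\ast$ such that for every $x\in X$ the map $\sigma_x:X\to X$, $y\mapsto x\ast y$, is bijective, and $(x\ast y)\ast(x\ast z)=(y\ast x)\ast(y\ast z)$ for all $x,y,z\in X$, and the diagonal map $x\mapsto x\ast x$ is bijective (for finite $X$ this last condition is automatic). A quasilinear cycle set is a pair $(A,\tau)$, where $A$ is an abelian group (written additively) and $\tau:A\to A$ is a bijection with $\tau(0)=0$, such that $A$ is a cycle set under the operation $a\ast b=\tau(b-a)-\tau(-a)$. *)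

theory Defs
  imports "HOL-Number_Theory.Residues"
begin

locale cycle_set =
  fixes X :: "'a set" and cyc :: "'a \<Rightarrow> 'a \<Rightarrow> 'a" (infixl \<open>\<star>\<close> 70)
  assumes bij_sigma: "x \<in> X \<Longrightarrow> bij_betw (\<lambda>y. x \<star> y) X X"
    and cycloid: "\<lbrakk>x \<in> X; y \<in> X; z \<in> X\<rbrakk> \<Longrightarrow> (x \<star> y) \<star> (x \<star> z) = (y \<star> x) \<star> (y \<star> z)"
    and bij_diagonal: "bij_betw (\<lambda>x. x \<star> x) X X"

(* Following HOL-Algebra, an additively written abelian group is a ring record of which
   abelian_group constrains only the additive part. *)
locale quasilinear_cycle_set = abelian_group A
  for A :: "('a, 'b) ring_scheme" (structure) +
  fixes \<tau> :: "'a \<Rightarrow> 'a"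
  assumes bij_tau: "bij_betw \<tau> (carrier A) (carrier A)"
    and tau_zero: "\<tau> \<zero> = \<zero>"
    and cycle_set: "cycle_set (carrier A) (\<lambda>a b. \<tau> (b \<ominus> a) \<ominus> \<tau> (\<ominus> a))"

end

theory Submission
  imports Defs
begin

text \<open>
  Write \<open>\<sigma> x y = x * y\<close>. By the cycle identity the steps \<open>g \<mapsto> \<sigma> (g x) \<circ> g\<close> commute, so a multiset
  \<open>M\<close> of residues yields a permutation \<open>\<Omega> M\<close> fixing 0. Quasilinearity makes iterated steps telescope
  to powers of \<open>\<tau>\<close>; since \<open>\<tau>\<close> permutes the \<open>p - 1\<close> nonzero residues, multiplicities matter only
  modulo \<open>E = (p - 1)!\<close>, which is coprime to \<open>p\<close>. Let \<open>K\<close> consist of the \<open>\<Omega> M\<close> with \<open>E\<close> dividing the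
  size of \<open>M\<close>; together with the translations \<open>T a\<close> it generates a group whose elements are uniquely
  \<open>T b \<circ> g\<close> with \<open>g \<in> K\<close>. Averaging over translations shows that only the identity of \<open>K\<close>
  normalizes the translations. Hence the conjugates of the \<open>T a\<close> with \<open>a \<noteq> 0\<close> by elements of \<open>K\<close> are
  pairwise distinct, and by counting they are all the \<open>T b \<circ> g\<close> with \<open>b \<noteq> 0\<close>. So no such element
  has a fixed point, which forces \<open>K = {id}\<close>. Then all \<open>\<sigma> x\<close> coincide, that is, \<open>\<tau>\<close> is additive.
\<close>

section \<open>Residues modulo \<open>p\<close> as integers and the commuting steps\<close>

locale quasilinear_residues =
  fixes p :: nat and t :: "int \<Rightarrow> int"
  assumes prime: "prime p"
    and t_mod: "t (x mod int p) = t x"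
    and t_reduced: "t x mod int p = t x"
    and t_inj: "t x = t y \<Longrightarrow> x mod int p = y mod int p"
    and t_zero: "t 0 = 0"
    and cycloid: "\<And>a b c. let s = \<lambda>a b. (t (b - a) - t (- a)) mod int p
                  in s (s a b) (s a c) = s (s b a) (s b c)"
begin

abbreviation m :: int where "m \<equiv> int p"

abbreviation R :: "int set" where "R \<equiv> {0..<m}"

lemma m_gt_1: "m > 1"
  using prime prime_gt_1_nat by auto

definition act :: "int \<Rightarrow> int \<Rightarrow> int" where
  "act a b = (t (b - a) - t (- a)) mod m"

lemma act_act: "act (act a b) (act a c) = act (act b a) (act b c)"
  using cycloid[of a b c] by (simp add: act_def Let_def)

lemma t_cong: "x mod m = y mod m \<Longrightarrow> t x = t y"
  by (metis t_mod)

definition step :: "int \<Rightarrow> (int \<Rightarrow> int) \<Rightarrow> int \<Rightarrow> int" where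
  "step x g = (\<lambda>y. act (g x) (g y))"

text \<open>At the argument \<open>z\<close>, commutation is the cycle identity for
  \<open>g x\<close>, \<open>g y\<close>, \<open>g z\<close>; it makes the fold over a multiset
  independent of order.\<close>

sublocale step: comp_fun_commute step
  by standard (simp add: fun_eq_iff step_def act_act)

definition Omega :: "int multiset \<Rightarrow> int \<Rightarrow> int" where
  "Omega M = fold_mset step (\<lambda>x. x mod m) M"

lemma Omega_empty [simp]: "Omega {#} = (\<lambda>x. x mod m)"
  by (simp add: Omega_def)

lemma Omega_add_mset [simp]: "Omega (add_mset x M) = step x (Omega M)"
  by (simp add: Omega_def)

lemma Omega_union: "Omega (M + N) = fold_mset step (Omega M) N"
  by (simp only: Omega_def step.fold_mset_union)

text \<open>Encodes the permutations of \<open>R\<close> fixing 0 as periodic functions on all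
  integers, so that arguments need no reduction. Surjectivity onto \<open>R\<close> follows by
  finiteness.\<close>

definition perms :: "(int \<Rightarrow> int) set" where
  "perms = {g. (\<forall>x. g (x mod m) = g x) \<and> (\<forall>x. g x mod m = g x) \<and>
               (\<forall>x y. g x = g y \<longrightarrow> x mod m = y mod m) \<and> g 0 = 0}"

lemma permsD:
  assumes "g \<in> perms"
  shows "g (x mod m) = g x" "g x mod m = g x" "g x = g y \<Longrightarrow> x mod m = y mod m" "g 0 = 0"
  using assms unfolding perms_def by blast+

lemma permsI:
  assumes "\<And>x. g (x mod m) = g x" "\<And>x. g x mod m = g x"
    and "\<And>x y. g x = g y \<Longrightarrow> x mod m = y mod m" "g 0 = 0"
  shows "g \<in> perms"
  using assms unfolding perms_def by blast

lemma perms_cong: "g \<in> perms \<Longrightarrow> x mod m = y mod m \<Longrightarrow> g x = g y"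
  by (metis permsD(1))

lemma perms_range: "g \<in> perms \<Longrightarrow> g x \<in> R"
  using permsD(2)[of g x] m_gt_1
  by (metis atLeastLessThan_iff dual_order.strict_trans pos_mod_bound pos_mod_sign zero_less_one)

lemma perms_eqI:
  assumes "g \<in> perms" "h \<in> perms" "\<And>x. x \<in> R \<Longrightarrow> g x = h x"
  shows "g = h"
proof
  fix x
  have "x mod m \<in> R" using m_gt_1 by simp
  then show "g x = h x" using assms by (metis permsD(1))
qed

lemma perms_inj_on: "g \<in> perms \<Longrightarrow> inj_on g R"
  by (intro inj_onI) (metis atLeastLessThan_iff mod_pos_pos_trivial permsD(3))

lemma perms_image: "g \<in> perms \<Longrightarrow> g ` R = R"
  by (intro endo_inj_surj) (auto intro: perms_inj_on simp del: atLeastLessThan_iff simp: perms_range)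

lemma finite_perms: "finite perms"
proof (rule inj_on_finite)
  show "inj_on (\<lambda>g. restrict g R) perms"
    by (intro inj_onI perms_eqI) (auto simp del: atLeastLessThan_iff, metis restrict_apply')
  show "(\<lambda>g. restrict g R) ` perms \<subseteq> PiE R (\<lambda>_. R)"
    using perms_range by (auto simp del: atLeastLessThan_iff)
qed (auto intro: finite_PiE)

lemma mod_in_perms: "(\<lambda>x. x mod m) \<in> perms"
  by (rule permsI) simp_all

lemma act_inj: "act a b = act a c \<Longrightarrow> b mod m = c mod m"
proof -
  assume "act a b = act a c"
  then have "t (b - a) mod m = t (c - a) mod m"
    unfolding act_def by (metis diff_add_cancel mod_add_left_eq)
  then have "(b - a) mod m = (c - a) mod m" by (metis t_inj t_reduced)
  then show "b mod m = c mod m" by (metis diff_add_cancel mod_add_left_eq)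
qed

lemma step_in_perms:
  assumes g: "g \<in> perms"
  shows "step x g \<in> perms"
proof (rule permsI)
  show "y mod m = z mod m" if "step x g y = step x g z" for y z
    using act_inj that[unfolded step_def] g by (metis permsD(2,3))
qed (simp_all add: step_def act_def permsD(1,2,4)[OF g] t_zero)

lemma Omega_in_perms: "Omega M \<in> perms"
  by (induction M) (simp_all add: mod_in_perms step_in_perms)

section \<open>Powers of \<open>t\<close> and the exponent \<open>E\<close>\<close>

lemma t_funpow_cong: "x mod m = y mod m \<Longrightarrow> (t ^^ k) x mod m = (t ^^ k) y mod m"
  by (induction k) (auto intro: arg_cong[of _ _ "\<lambda>x. x mod m"] t_cong)

lemma t_funpow_zero: "(t ^^ k) 0 = 0"
  by (induction k) (simp_all add: t_zero)

lemma t_funpow_inj: "(t ^^ k) x mod m = (t ^^ k) y mod m \<Longrightarrow> x mod m = y mod m"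
  by (induction k) (auto simp: t_reduced dest: t_inj)

definition E :: nat where "E = fact (p - 1)"

lemma E_pos: "E > 0"
  by (simp add: E_def)

lemma coprime_p_E: "coprime p E"
  using prime prime_gt_1_nat[OF prime] by (auto simp: E_def prime_imp_coprime prime_dvd_fact_iff)

text \<open>The orbit of a nonzero residue avoids 0, so it returns after some \<open>d\<close> with
  0 < \<open>d\<close> \<le> \<open>p - 1\<close>, and such a \<open>d\<close> divides the factorial
  \<open>E\<close>.\<close>

lemma t_funpow_E: "(t ^^ E) x mod m = x mod m"
proof (cases "x mod m = 0")
  case True
  then show ?thesis using t_funpow_cong[of x 0 E] by (simp add: t_funpow_zero)
next
  case False
  let ?f = "\<lambda>k. (t ^^ k) x mod m"
  have "?f k \<in> {1..<m}" for k
  proof -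
    have "?f k \<noteq> 0"
      using t_funpow_inj[of k x 0] False by (auto simp: t_funpow_zero)
    moreover have "?f k \<ge> 0" "?f k < m" using m_gt_1 by simp_all
    ultimately show ?thesis by simp
  qed
  then have "?f ` {0..p - 1} \<subseteq> {1..<m}" by blast
  then have "card (?f ` {0..p - 1}) \<le> card {1..<m}" by (intro card_mono) auto
  also have "\<dots> < card {0..p - 1}" using m_gt_1 by auto
  finally have "\<not> inj_on ?f {0..p - 1}" by (rule pigeonhole)
  then obtain i j where ij: "i < j" "j \<le> p - 1" "?f i = ?f j"
    by (auto simp: inj_on_def) (metis linorder_neqE_nat)
  define d where "d = j - i"
  have d: "d > 0" "d \<le> p - 1" using ij by (auto simp: d_def)
  have "(t ^^ j) x = (t ^^ i) ((t ^^ d) x)"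
    using ij by (metis comp_apply d_def funpow_add le_add_diff_inverse less_imp_le)
  \<comment> \<open>Injectivity cancels the common first \<open>i\<close> iterations.\<close>
  then have fix_d: "(t ^^ d) x mod m = x mod m"
    using ij(3) by (metis t_funpow_inj)
  have "(t ^^ (d * k)) x mod m = x mod m" for k
  proof (induction k)
    case (Suc k)
    have "(t ^^ (d * Suc k)) x mod m = (t ^^ d) ((t ^^ (d * k)) x) mod m"
      by (simp add: funpow_add)
    also have "\<dots> = (t ^^ d) x mod m" by (rule t_funpow_cong[OF Suc])
    finally show ?case using fix_d by simp
  qed simp
  moreover have "d dvd E" using d by (simp add: E_def dvd_fact)
  ultimately show ?thesis by (auto elim: dvdE)
qed

text \<open>The subtracted constant drops out of every difference of two values, so repeated steps
  at \<open>x\<close> merely iterate \<open>t\<close>.\<close>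

lemma step_funpow:
  assumes "g \<in> perms"
  shows "(step x ^^ k) g = (\<lambda>y. ((t ^^ k) (g y - g x) - (t ^^ k) (- g x)) mod m)"
proof (induction k)
  case 0
  show ?case using assms by (simp add: permsD(1,2,4))
next
  case (Suc k)
  have "t ((step x ^^ k) g y - (step x ^^ k) g x) = t ((t ^^ k) (g y - g x))" for y
    by (rule t_cong) (simp add: Suc t_funpow_zero mod_simps)
  moreover have "t (- (step x ^^ k) g x) = t ((t ^^ k) (- g x))"
    by (rule t_cong) (simp add: Suc t_funpow_zero mod_simps)
  ultimately show ?case by (simp add: step_def[of x "(step x ^^ k) g"] act_def)
qed

lemma step_funpow_E:
  assumes "g \<in> perms"
  shows "(step x ^^ E) g = g"
proof
  fix y
  have "(step x ^^ E) g y = ((g y - g x) mod m - (- g x) mod m) mod m"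
    unfolding step_funpow[OF assms] by (metis mod_diff_eq t_funpow_E)
  also have "\<dots> = g y" using assms by (simp add: mod_simps permsD(1,2,4))
  finally show "(step x ^^ E) g y = g y" .
qed

lemma Omega_replicate_union: "Omega (replicate_mset k x + M) = (step x ^^ k) (Omega M)"
  by (induction k) auto

lemma Omega_repeat_E: "Omega (repeat_mset (E * k) N + M) = Omega M"
proof (induction N)
  case (add x N)
  have E_k: "(step x ^^ (E * k)) g = g" if "g \<in> perms" for g
    by (induction k) (simp_all add: funpow_add step_funpow_E that)
  have "Omega (repeat_mset (E * k) (add_mset x N) + M) =
        Omega (replicate_mset (E * k) x + (repeat_mset (E * k) N + M))"
    by (simp add: ac_simps)
  then show ?case
    by (simp add: Omega_replicate_union add E_k Omega_in_perms)
qed simp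

section \<open>Composition and translation rules for \<open>Omega\<close>\<close>

lemma step_comp: "step x (h \<circ> g) = step (g x) h \<circ> g"
  by (simp add: step_def fun_eq_iff)

lemma fold_step_comp: "fold_mset step (h \<circ> g) M = fold_mset step h (image_mset g M) \<circ> g"
  by (induction M) (simp_all only: fold_mset_empty step.fold_mset_add_mset image_mset_empty
      image_mset_add_mset step_comp)

text \<open>A cocycle rule: steps performed after \<open>M\<close> see their base points only
  through \<open>Omega M\<close>.\<close>

lemma Omega_union_comp: "Omega (M + N) = Omega (image_mset (Omega M) N) \<circ> Omega M"
proof -
  have "Omega M = (\<lambda>x. x mod m) \<circ> Omega M"
    by (simp add: fun_eq_iff permsD(1,2,4)[OF Omega_in_perms])
  then show ?thesis
    unfolding Omega_union by (metis Omega_def fold_step_comp)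
qed

text \<open>With \<open>T a\<close> the translation by \<open>a\<close>, \<open>g \<circ> T a = T (g a) \<circ> shift a g\<close>.\<close>

definition shift :: "int \<Rightarrow> (int \<Rightarrow> int) \<Rightarrow> int \<Rightarrow> int" where
  "shift a g = (\<lambda>y. (g (y + a) - g a) mod m)"

text \<open>Translating the argument only moves the base point, since the constant
  \<open>g a\<close> cancels in the differences inside \<open>act\<close>.\<close>

lemma shift_step:
  assumes "g \<in> perms"
  shows "shift a (step x g) = step ((x - a) mod m) (shift a g)"
proof -
  have g: "g ((x - a) mod m + a) = g x"
    by (rule perms_cong[OF assms]) (simp add: mod_simps)
  have "t ((g (y + a) - g a) mod m - (g x - g a) mod m) = t (g (y + a) - g x)" for y
    by (rule t_cong) (simp add: mod_simps)
  moreover have "t (- ((g x - g a) mod m)) = t (g a - g x)"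
    by (rule t_cong) (simp add: mod_simps)
  ultimately show ?thesis
    unfolding shift_def step_def act_def g by (simp add: mod_simps)
qed

lemma shift_Omega: "shift a (Omega M) = Omega (image_mset (\<lambda>x. (x - a) mod m) M)"
  by (induction M) (simp_all add: shift_step Omega_in_perms, simp add: shift_def fun_eq_iff mod_simps)

section \<open>The finite group \<open>K\<close>\<close>

definition K :: "(int \<Rightarrow> int) set" where
  "K = {Omega M | M. set_mset M \<subseteq> R \<and> E dvd size M}"

lemma K_perms: "K \<subseteq> perms"
  by (auto simp: K_def Omega_in_perms)

lemma finite_K: "finite K"
  using K_perms finite_perms by (rule finite_subset)

lemma Omega_in_K: "set_mset M \<subseteq> R \<Longrightarrow> E dvd size M \<Longrightarrow> Omega M \<in> K"
  by (auto simp: K_def)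

lemma shift_in_K:
  assumes "g \<in> K"
  shows "shift a g \<in> K"
proof -
  obtain M where "g = Omega M" "E dvd size M" using assms by (auto simp: K_def)
  then show ?thesis
    using m_gt_1 by (auto simp: shift_Omega intro!: Omega_in_K)
qed

lemma comp_in_K:
  assumes "h \<in> K" "g \<in> K"
  shows "h \<circ> g \<in> K"
proof -
  obtain M N where M: "g = Omega M" "set_mset M \<subseteq> R" "E dvd size M"
    and N: "h = Omega N" "set_mset N \<subseteq> R" "E dvd size N"
    using assms by (auto simp: K_def)
  have im: "g ` R = R" using M by (simp add: perms_image Omega_in_perms)
  \<comment> \<open>Pulling \<open>N\<close> back along \<open>g\<close> compensates the relabelling
    in the cocycle rule.\<close>
  define N' where "N' = image_mset (inv_into R g) N"
  have "image_mset g N' = image_mset id N"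
    unfolding N'_def multiset.map_comp using N(2) im
    by (intro image_mset_cong) (auto simp: f_inv_into_f)
  then have "h \<circ> g = Omega (M + N')"
    by (simp add: M(1) N(1) Omega_union_comp)
  moreover have "set_mset N' \<subseteq> R"
    using N(2) im by (auto simp: N'_def simp del: atLeastLessThan_iff intro!: inv_into_into)
  moreover have "size N' = size N" by (simp add: N'_def)
  ultimately show ?thesis using M N by (simp add: Omega_in_K)
qed

text \<open>Composition with \<open>h\<close> is an injective self-map of the finite set
  \<open>K\<close>, hence onto; this replaces explicit inverses.\<close>

lemma K_left_division:
  assumes "h \<in> K" "g \<in> K"
  obtains w where "w \<in> K" "h \<circ> w = g"
proof -
  have "inj_on (\<lambda>w. h \<circ> w) K"
  proof (intro inj_onI ext)
    fix v w x assume "v \<in> K" "w \<in> K" "h \<circ> v = h \<circ> w"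
    then have "v x mod m = w x mod m"
      using assms(1) K_perms by (metis comp_apply permsD(3) subsetD)
    then show "v x = w x" using \<open>v \<in> K\<close> \<open>w \<in> K\<close> K_perms permsD(2) by (metis subsetD)
  qed
  then have "(\<lambda>w. h \<circ> w) ` K = K"
    using comp_in_K[OF assms(1)] by (intro endo_inj_surj finite_K) auto
  then show ?thesis using assms(2) that by (metis imageE)
qed

lemma K_right_division:
  assumes "h \<in> K" "g \<in> K"
  obtains w where "w \<in> K" "w \<circ> h = g"
proof -
  have "inj_on (\<lambda>w. w \<circ> h) K"
  proof (intro inj_onI)
    fix v w assume vw: "v \<in> K" "w \<in> K" "v \<circ> h = w \<circ> h"
    have im: "h ` R = R" using assms K_perms by (intro perms_image) auto
    show "v = w"
    proof (rule perms_eqI)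
      fix x assume "x \<in> R"
      then obtain y where "x = h y" using im by blast
      then show "v x = w x" using vw(3) by (metis comp_apply)
    qed (use vw K_perms in auto)
  qed
  then have "(\<lambda>w. w \<circ> h) ` K = K"
    using comp_in_K[OF _ assms(1)] by (intro endo_inj_surj finite_K) auto
  then show ?thesis using assms(2) that by (metis imageE)
qed

section \<open>Averaging over translations\<close>

lemma sum_shifts:
  assumes "set_mset M \<subseteq> R"
  shows "(\<Sum>a\<in>R. image_mset (\<lambda>x. (x - a) mod m) M) = repeat_mset (size M) (mset_set R)"
  using assms
proof (induction M)
  case (add x M)
  have inj: "inj_on (\<lambda>a. (x - a) mod m) R"
  proof (rule inj_onI)
    fix a b assume ab: "a \<in> R" "b \<in> R" "(x - a) mod m = (x - b) mod m"
    then have "(x - (x - a)) mod m = (x - (x - b)) mod m" by (metis mod_diff_right_eq)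
    with ab show "a = b" by simp
  qed
  have "(\<Sum>a\<in>R. {#(x - a) mod m#}) = image_mset (\<lambda>a. (x - a) mod m) (mset_set R)"
    by (simp add: sum_unfold_sum_mset)
  also have "\<dots> = mset_set ((\<lambda>a. (x - a) mod m) ` R)"
    by (rule image_mset_mset_set[OF inj])
  also have "(\<lambda>a. (x - a) mod m) ` R = R"
    using inj m_gt_1 by (intro endo_inj_surj) auto
  finally have "(\<Sum>a\<in>R. add_mset ((x - a) mod m) (image_mset (\<lambda>x. (x - a) mod m) M)) =
      mset_set R + (\<Sum>a\<in>R. image_mset (\<lambda>x. (x - a) mod m) M)"
    using sum.distrib[of "\<lambda>a. {#(x - a) mod m#}" "\<lambda>a. image_mset (\<lambda>x. (x - a) mod m) M" R] by simp
  then show ?case using add by simp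
qed simp

text \<open>\<open>Omega (M + N)\<close> depends on \<open>M\<close> only through
  \<open>Omega M\<close>, so the summands can be exchanged one at a time.\<close>

lemma Omega_sum:
  assumes "finite A" "\<And>a. a \<in> A \<Longrightarrow> Omega (f a) = Omega M"
  shows "Omega (\<Sum>a\<in>A. f a) = Omega (repeat_mset (card A) M)"
  using assms
proof (induction A rule: finite_induct)
  case (insert a A)
  have "Omega (f a + sum f A) = Omega (M + sum f A)"
    using insert.prems by (simp add: Omega_union)
  also have "\<dots> = Omega (repeat_mset (card A) M + M)"
    using insert by (simp add: add.commute[of M] Omega_union)
  finally show ?case using insert.hyps by (simp add: add.commute)
qed simp

text \<open>All \<open>p\<close> translates of \<open>M\<close> have the same \<open>Omega\<close>,
  so \<open>p\<close> copies of \<open>M\<close> act like their sum. There every residue has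
  multiplicity \<open>size M\<close>, divisible by \<open>E\<close>, so this action is
  trivial.\<close>

lemma shift_invariant_in_K:
  assumes "w \<in> K" "\<And>a. shift a w = w"
  shows "w = (\<lambda>x. x mod m)"
proof -
  obtain M where M: "w = Omega M" "set_mset M \<subseteq> R" "E dvd size M"
    using assms by (auto simp: K_def)
  have "Omega (repeat_mset p M) = Omega (\<Sum>a\<in>R. image_mset (\<lambda>x. (x - a) mod m) M)"
    using assms(2) M(1) by (subst Omega_sum[of _ _ M]) (auto simp: shift_Omega)
  also have "\<dots> = Omega (repeat_mset (size M) (mset_set R) + {#})"
    by (simp add: sum_shifts M)
  also have "\<dots> = Omega {#}"
    using M(3) by (metis Omega_repeat_E dvdE)
  finally have p: "Omega (repeat_mset p M) = Omega {#}" .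
  have pk: "Omega (repeat_mset (p * k) M) = Omega {#}" for k
  proof (induction k)
    case (Suc k)
    have "Omega (repeat_mset (p * Suc k) M) = Omega (repeat_mset p M + repeat_mset (p * k) M)"
      by (simp add: repeat_mset_distrib)
    also have "\<dots> = Omega ({#} + repeat_mset (p * k) M)"
      using p by (simp only: Omega_union)
    finally show ?case using Suc by simp
  qed simp
  obtain u v where "p * u = E * v + 1"
    using coprime_p_E prime_gt_0_nat[OF prime] bezout_nat[of p E] by auto
  then have "Omega (repeat_mset (p * u) M) = Omega (repeat_mset (E * v) M + M)"
    by (simp add: add.commute)
  then show ?thesis using M(1) pk[of u] by (simp add: Omega_repeat_E)
qed

section \<open>Counting conjugates of translations\<close>

lemma multiples:
  assumes "a mod m \<noteq> 0"
  obtains j where "y mod m = (int j * a) mod m"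
proof -
  have "coprime a m"
    using assms prime by (metis coprime_commute dvd_imp_mod_0 prime_imp_coprime prime_nat_int_transfer)
  then obtain b where "[a * b = 1] (mod m)" using cong_solve_coprime_int by blast
  then have "[a * b * y = 1 * y] (mod m)" by (rule cong_scalar_right)
  moreover have "int (nat ((b * y) mod m)) = (b * y) mod m" using m_gt_1 by simp
  ultimately have "y mod m = (int (nat ((b * y) mod m)) * a) mod m"
    by (simp add: cong_def mod_simps ac_simps)
  then show ?thesis by (rule that)
qed

text \<open>
  The equation \<open>g \<circ> h = shift a h\<close> with \<open>b = h a\<close> says that \<open>T b \<circ> g\<close> is the conjugate of \<open>T a\<close> by \<open>h\<close>.
\<close>

lemma conjugate_determines:
  assumes h: "h \<in> K" "h' \<in> K" and a: "a \<in> R - {0}" "a' \<in> R - {0}"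
    and eq: "h a = h' a'" and g: "g \<circ> h = shift a h" "g \<circ> h' = shift a' h'"
  shows "h = h' \<and> a = a'"
proof -
  have perms: "h \<in> perms" "h' \<in> perms" using h K_perms by auto
  \<comment> \<open>The conjugate of \<open>T c\<close> by \<open>f\<close> sends \<open>z\<close>
    to \<open>g z + f c\<close>; iterating it from 0 recovers \<open>f\<close> on the multiples of
    \<open>c\<close>.\<close>
  have iter: "f (int j * c) = ((\<lambda>z. (g z + f c) mod m) ^^ j) 0"
    if "f \<in> perms" "g \<circ> f = shift c f" for f c j
  proof (induction j)
    case 0
    show ?case using that by (simp add: permsD(1,2,4))
  next
    case (Suc j)
    have "g (f (int j * c)) = (f (int j * c + c) - f c) mod m"
      using fun_cong[OF that(2), of "int j * c"] by (simp add: shift_def)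
    then have "(g (f (int j * c)) + f c) mod m = f (int (Suc j) * c)"
      using that(1) by (simp add: mod_simps permsD(1,2,4) algebra_simps)
    then show ?case using Suc by simp
  qed
  have mult: "h (int j * a) = h' (int j * a')" for j
    using iter[OF perms(1) g(1)] iter[OF perms(2) g(2)] eq by simp
  \<comment> \<open>The quotient \<open>w\<close> of \<open>h\<close> by \<open>h'\<close> takes
    each \<open>j * a\<close> to \<open>j * a'\<close>. As \<open>a\<close> generates all residues,
    \<open>w\<close> is additive and hence shift-invariant.\<close>
  obtain w where w: "w \<in> K" "h' \<circ> w = h" using K_left_division h by metis
  then have w_perms: "w \<in> perms" using K_perms by auto
  have w_mult: "w (int j * a) = (int j * a') mod m" for j
    using mult[of j] w(2) perms w_perms by (metis comp_apply permsD(2,3))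
  have "shift b w y = w y" for b y
  proof -
    obtain i j where i: "y mod m = (int i * a) mod m" and j: "b mod m = (int j * a) mod m"
      using multiples a by (metis DiffE atLeastLessThan_iff mod_pos_pos_trivial singletonI)
    have "(y + b) mod m = (int (i + j) * a) mod m"
      using i j by (metis mod_add_eq of_nat_add distrib_right)
    then have "w (y + b) = (int (i + j) * a') mod m"
      using w_mult perms_cong[OF w_perms] by metis
    moreover have "w b = (int j * a') mod m" "w y = (int i * a') mod m"
      using w_mult perms_cong[OF w_perms] i j by metis+
    ultimately show ?thesis by (simp add: shift_def mod_simps algebra_simps)
  qed
  then have "w = (\<lambda>x. x mod m)" using shift_invariant_in_K w(1) by blast
  then have "h = h'" using w(2) perms by (auto simp: fun_eq_iff permsD(1,2,4))
  moreover from this have "a mod m = a' mod m" using eq perms permsD(3) by metis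
  ultimately show ?thesis using a by simp
qed

lemma K_trivial: "K \<subseteq> {\<lambda>x. x mod m}"
proof
  fix g assume g: "g \<in> K"
  \<comment> \<open>The conjugate of \<open>T a\<close> by \<open>h\<close> is
    \<open>T (h a) \<circ> quot h a\<close>.\<close>
  define quot where "quot h a = (SOME g. g \<in> K \<and> g \<circ> h = shift a h)" for h a
  have quot: "quot h a \<in> K" "quot h a \<circ> h = shift a h" if "h \<in> K" for h a
    using someI_ex[of "\<lambda>g. g \<in> K \<and> g \<circ> h = shift a h"] K_right_division[OF that shift_in_K[OF that]]
    unfolding quot_def by metis+
  let ?\<Phi> = "\<lambda>(h, a). (quot h a, h a)"
  let ?S = "K \<times> (R - {0})"
  have determined: "h = h' \<and> a = a'"
    if "h \<in> K" "h' \<in> K" "a \<in> R - {0}" "a' \<in> R - {0}" "quot h a = quot h' a'" "h a = h' a'"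
    for h h' a a'
    using that quot(2)[of h a] quot(2)[of h' a']
    by (intro conjugate_determines[of _ _ _ _ "quot h a"]) simp_all
  have "inj_on ?\<Phi> ?S"
  proof (rule inj_onI)
    fix u v assume "u \<in> ?S" "v \<in> ?S" "?\<Phi> u = ?\<Phi> v"
    moreover obtain h a h' a' where "u = (h, a)" "v = (h', a')" by (metis surj_pair)
    ultimately show "u = v"
      using determined[of h h' a a'] by (simp only: mem_Sigma_iff prod.case prod.inject)
  qed
  moreover have "(quot h a, h a) \<in> ?S" if h: "h \<in> K" and a: "a \<in> R" "a \<noteq> 0" for h a
  proof -
    have perm: "h \<in> perms" using h K_perms by auto
    have "h a \<noteq> 0" using permsD(3)[OF perm, of a 0] permsD(4)[OF perm] a by auto
    then show ?thesis using h quot perms_range[OF perm] by blast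
  qed
  then have "?\<Phi> ` ?S \<subseteq> ?S" by (auto simp del: atLeastLessThan_iff)
  \<comment> \<open>An injective self-map of a finite set is onto: every
    \<open>T b \<circ> g\<close> with \<open>b \<noteq> 0\<close> is a conjugate of some
    \<open>T a\<close> with \<open>a \<noteq> 0\<close>.\<close>
  ultimately have surj: "?\<Phi> ` ?S = ?S"
    by (intro endo_inj_surj) (auto simp: finite_K)
  have "g x = x" if x: "x \<in> R" for x
  proof (rule ccontr)
    \<comment> \<open>Chosen so that \<open>T b \<circ> g\<close> fixes \<open>x\<close>; the
      preimage \<open>y\<close> of \<open>x\<close> under \<open>h\<close> would then be fixed by
      \<open>T a\<close>.\<close>
    define b where "b = (x - g x) mod m"
    assume "g x \<noteq> x"
    have "g x \<in> R" using g K_perms perms_range by blast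
    then have "b \<noteq> 0" using \<open>g x \<noteq> x\<close> x
      by (auto simp: b_def) (metis mod_pos_pos_trivial mod_eq_dvd_iff)
    then have "(g, b) \<in> ?S" using g m_gt_1 by (auto simp: b_def)
    then obtain h a where ha: "h \<in> K" "a \<in> R" "a \<noteq> 0" "quot h a = g" "h a = b"
      using surj by (smt (verit) DiffE Pair_inject SigmaE case_prod_conv imageE singletonI)
    have h: "h \<in> perms" using ha K_perms by auto
    obtain y where y: "h y = x" using perms_image[OF h] x by (metis imageE)
    have "g x = (h (y + a) - b) mod m"
      using fun_cong[OF quot(2)[OF ha(1), of a], of y] ha y by (simp add: shift_def)
    then have "(g x + b) mod m = h (y + a)"
      using h by (simp add: mod_simps permsD(1,2,4))
    moreover have "(g x + b) mod m = h y"
      using x y by (simp add: b_def mod_simps)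
    ultimately have "(y + a) mod m = y mod m" using permsD(3)[OF h] by metis
    then have "m dvd (y + a) - y" by (simp only: mod_eq_dvd_iff)
    then show False using ha(2,3) by (auto dest: zdvd_imp_le)
  qed
  then show "g \<in> {\<lambda>x. x mod m}"
    using perms_eqI[OF _ mod_in_perms] g K_perms by auto
qed

section \<open>Additivity of \<open>t\<close>\<close>

lemma t_add: "t (x + y) = (t x + t y) mod m"
proof -
  \<comment> \<open>With base point \<open>-x\<close>, \<open>act\<close> compares
    \<open>t (x + y)\<close> with \<open>t x\<close>; with base point 0 it gives
    \<open>t y\<close>.\<close>
  define x' where "x' = (- x) mod m"
  have x': "x' \<in> R" using m_gt_1 by (simp add: x'_def)
  have E: "Suc (E - 1) = E" using E_pos by simp
  have "Omega (add_mset x' (replicate_mset (E - 1) 0)) \<in> K"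
    using x' E m_gt_1 by (intro Omega_in_K) (auto simp: set_mset_replicate_mset_subset)
  then have *: "Omega (add_mset x' (replicate_mset (E - 1) 0)) = Omega {#}"
    using K_trivial by auto
  \<comment> \<open>One multiset read in two ways: dropping \<open>E\<close> zeros leaves
    \<open>x'\<close>, while dropping \<open>x'\<close> with \<open>E - 1\<close> zeros, a trivial
    element of \<open>K\<close>, leaves a single 0.\<close>
  have "replicate_mset E 0 + {#x'#} = add_mset 0 (add_mset x' (replicate_mset (E - 1) 0))"
    using arg_cong[OF E, of "\<lambda>k. replicate_mset k (0 :: int)"] by (simp add: add_mset_commute)
  then have "Omega {#x'#} = Omega (add_mset 0 (add_mset x' (replicate_mset (E - 1) 0)))"
    using Omega_repeat_E[of 1 "{#0#}" "{#x'#}"] by (simp add: add_mset_commute del: Omega_add_mset)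
  also have "\<dots> = Omega {#0#}" using * by simp
  finally have "act (x' mod m) (y mod m) = act 0 (y mod m)"
    by (simp add: step_def fun_eq_iff)
  moreover have "t (y mod m - x' mod m) = t (x + y)" "t (- (x' mod m)) = t x" "t (y mod m) = t y"
    by (auto intro!: t_cong simp: x'_def mod_simps add.commute)
  ultimately have "(t (x + y) - t x) mod m = t y"
    by (simp add: act_def t_zero t_reduced)
  then have "(t x + t y) mod m = t (x + y) mod m"
    by (metis add.commute diff_add_cancel mod_add_left_eq)
  then show ?thesis by (simp add: t_reduced)
qed

lemma t_of_nat: "t (int n) = (t 1 * int n) mod m"
proof (induction n)
  case (Suc n)
  have "t (int (Suc n)) = (t 1 + t (int n)) mod m"
    using t_add[of 1 "int n"] by simp
  then show ?case by (simp add: Suc mod_simps algebra_simps)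
qed (simp add: t_zero)

end

section \<open>Transfer to \<open>residue_ring\<close>\<close>

theorem corollary4p8:
  fixes p :: nat and \<tau> :: "int \<Rightarrow> int"
  assumes "prime p"
    and "quasilinear_cycle_set (residue_ring (int p)) \<tau>"
  shows "\<exists>\<alpha> \<in> carrier (residue_ring (int p)) - {\<zero>\<^bsub>residue_ring (int p)\<^esub>}.
           \<forall>a \<in> carrier (residue_ring (int p)). \<tau> a = \<alpha> \<otimes>\<^bsub>residue_ring (int p)\<^esub> a"
proof -
  have p: "int p > 1" using assms(1) prime_gt_1_nat by auto
  interpret residues "int p" "residue_ring (int p)"
    using p by unfold_locales auto
  interpret Q: quasilinear_cycle_set "residue_ring (int p)" \<tau> by fact
  interpret C: cycle_set "carrier (residue_ring (int p))"
    "\<lambda>a b. \<tau> (b \<ominus>\<^bsub>residue_ring (int p)\<^esub> a) \<ominus>\<^bsub>residue_ring (int p)\<^esub> \<tau> (\<ominus>\<^bsub>residue_ring (int p)\<^esub> a)"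
    by (rule Q.cycle_set)
  have carrier: "carrier (residue_ring (int p)) = {0..<int p}"
    by (auto simp: res_carrier_eq)
  have minus: "a \<ominus>\<^bsub>residue_ring (int p)\<^esub> b = (a - b) mod int p" for a b
    by (simp add: a_minus_def res_neg_eq res_add_eq mod_simps)
  \<comment> \<open>The periodic extension of \<open>\<tau>\<close> to all integers.\<close>
  define t where "t x = \<tau> (x mod int p)" for x
  have t_range: "t x \<in> {0..<int p}" for x
    using Q.bij_tau p unfolding carrier t_def bij_betw_def by force
  interpret quasilinear_residues p t
  proof
    show "t x = t y \<Longrightarrow> x mod int p = y mod int p" for x y
      using Q.bij_tau p unfolding carrier t_def bij_betw_def inj_on_def by simp
    show "t x mod int p = t x" for x using t_range[of x] by simp
    show "t 0 = 0" using Q.tau_zero by (simp add: t_def res_zero_eq)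
    show "let s = \<lambda>a b. (t (b - a) - t (- a)) mod int p in s (s a b) (s a c) = s (s b a) (s b c)"
      for a b c
      using C.cycloid[of "a mod int p" "b mod int p" "c mod int p"] p
      by (simp add: Let_def carrier minus res_neg_eq t_def mod_simps)
  qed (use assms(1) in \<open>simp_all add: t_def\<close>)
  have "t 1 \<noteq> 0" using t_inj[of 1 0] t_zero p by auto
  moreover have "\<tau> a = (t 1 * a) mod int p" if "a \<in> {0..<int p}" for a
    using t_of_nat[of "nat a"] that by (simp add: t_def)
  ultimately show ?thesis
    using t_range by (auto simp: carrier res_mult_eq res_zero_eq intro!: bexI[of _ "t 1"])
qed

end
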